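(* Let $f$ be a convex, $(k,L,\delta)$-apx-PWS function on $X$, and run the $\mathcal W$-certificate search subroutine on $f$ with inputs $\bar x\in X$, $\Delta>0$, $m$, and $\iota_{\max}=+\infty$. Then: (a) If $f(\bar x)-f^*\le\Delta$, the subroutine is guaranteed to return a $\mathcal W$-stationarity certificate, via either exit (R2) or exit (R4). (b) If the subroutine terminates at exit (R2), the returned certificate implies the optimality gap bound $f(\bar x)-f^*\le2\Delta$. (c) If the subroutine terminates at exit (R4) and $f$ satisfies the quadratic growth condition with modulus $\mu>0$, the returned certificate implies $$f(\bar x)-f^*\le\max\Big\{2,\frac{32\tilde L}{\mu}\Big\}\Delta,$$ where $\tilde L$ is the empirical smoothness constant computed by the subroutine. If in addition $\delta\le\frac16\Delta$ and $m\ge k$, then $f(\bar x)-f^*\le\max\{2,\frac{32L}{\mu}\}\Delta$.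
   Context: $X\subseteq\mathbb{R}^n$ is closed and convex, $f:X\to\mathbb{R}$ is Lipschitz continuous and bounded below, $f^*=\min_Xf$, the minimizer set $X^*$ is non-empty, $f'(x)$ is a subgradient, and $l_f(x;\bar x)=f(\bar x)+\langle f'(\bar x),x-\bar x\rangle$. Quadratic growth with modulus $\mu$: $f(x)-f^*\ge\frac\mu2\operatorname{dist}^2(x,X^* )$ for all $x\in X$. $(k,L,\delta)$-apx-PWS ($L,\delta\ge0$): there is a covering $X\subseteq\cup_{i=1}^kX_i$ and an oracle which, queried at $\bar x\in X$, returns an affine function $\tilde l_f(\cdot;\bar x)$ with $f(y)\ge\tilde l_f(y;\bar x)$ for all $y\in X$ and, if $\bar x\in X_i$, $f(y)-\tilde l_f(y;\bar x)\le\frac L2\|y-\bar x\|^2+\delta$ for all $y\in X_i$. $\mathcal W$-stationarity certificate: for search points $\{x^i\}\subset X$ and $\iota>0$, let $\psi(x)=\max\{\max_i\tilde l_f(x;x^i),\,l_f(x;\bar x)\}$ and $\mathcal V_\iota(\bar x)=\frac1\iota\max_{x\in X,\|x-\bar x\|\le\iota}(\psi(\bar x)-\psi(x))$. The points form an $(\iota,\nu)$-$\mathcal W$-stationarity certificate for $\bar x$ if $\|x^i-\bar x\|\le\iota$ for all $i$ and $\mathcal V_\iota(\bar x)\le\nu$. $\mathcal W$-certificate search subroutine (inputs $f,\bar x,\Delta,m,\iota_{\max}$): set $x^0=\bar x$, $l=f(\bar x)-2\Delta$. For $t=0,1,\dots,m$: let $X(t)=\{x\in X:l_f(x;x^0)\le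 l,\ \tilde l_f(x;x^i)\le l,\ i=1,\dots,t\}$ and $x^{t+1}=\arg\min_{x\in X(t)}\|x-\bar x\|^2$; if $X(t)=\emptyset$ set $\|x^{t+1}-\bar x\|=+\infty$. (R1) If $\|x^{t+1}-\bar x\|>\iota_{\max}$, return $\{x^i\}_{0\le i\le t}$ as an $(\iota_{\max},2\Delta/\iota_{\max})$-certificate. (R2) If $\|x^{t+1}-\bar x\|=+\infty$, return $\{x^i\}_{0\le i\le t}$ as an $(\mathbb M,2\Delta/\mathbb M)$-certificate, where $\mathbb M$ is an arbitrarily large constant (proxy for an infinite radius). After the loop compute $\tilde L=\min_{1\le l<r\le m+1}\frac{2(f(x^r)-\tilde l_f(x^r;x^l)-\Delta/6)}{\|x^l-x^r\|^2}$. (R3) If $\|\bar x-x^{m+1}\|<\frac12\sqrt{\Delta/\tilde L}$ (with $\Delta/\tilde L$ read as $+\infty$ if $\tilde L\le0$), return False. (R4) Otherwise set $\iota=\|\bar x-x^{m+1}\|$ and return $\{x^i\}_{0\le i\le m}$ as an $(\iota,2\Delta/\iota)$-certificate. *)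

theory Defs
  imports "HOL-Analysis.Analysis"
begin

text \<open>The objective is a function \<open>f\<close> of which only the values on the feasible set \<open>X\<close> matter.
  Linearizations take the base point first: \<open>lin f g z y\<close> is $l_f(y; z)$ for the subgradient
  selection \<open>g\<close>, and an oracle \<open>lt\<close> is a function for which \<open>lt z y\<close> is $\tilde l_f(y; z)$.\<close>

definition min_val :: "'a set \<Rightarrow> ('a \<Rightarrow> real) \<Rightarrow> real" where
  "min_val X f = (INF x\<in>X. f x)"

definition minimizers :: "'a set \<Rightarrow> ('a \<Rightarrow> real) \<Rightarrow> 'a set" where
  "minimizers X f = {x \<in> X. \<forall>y\<in>X. f x \<le> f y}"

definition is_subgradient :: "'a::euclidean_space set \<Rightarrow> ('a \<Rightarrow> real) \<Rightarrow> 'a \<Rightarrow> 'a \<Rightarrow> bool" where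
  "is_subgradient X f x v \<longleftrightarrow> (\<forall>y\<in>X. f y \<ge> f x + v \<bullet> (y - x))"

definition lin :: "('a::euclidean_space \<Rightarrow> real) \<Rightarrow> ('a \<Rightarrow> 'a) \<Rightarrow> 'a \<Rightarrow> 'a \<Rightarrow> real" where
  "lin f g z y = f z + g z \<bullet> (y - z)"

definition quadratic_growth :: "'a::euclidean_space set \<Rightarrow> ('a \<Rightarrow> real) \<Rightarrow> real \<Rightarrow> bool" where
  "quadratic_growth X f \<mu> \<longleftrightarrow>
     (\<forall>x\<in>X. f x - min_val X f \<ge> \<mu> / 2 * (infdist x (minimizers X f))\<^sup>2)"

definition affine_fun :: "('a::euclidean_space \<Rightarrow> real) \<Rightarrow> bool" where
  "affine_fun h \<longleftrightarrow> (\<exists>a c. \<forall>y. h y = a \<bullet> y + c)"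

text \<open>\<open>f\<close> is $(k,L,\delta)$-apx-PWS on \<open>X\<close> if it has such an oracle \<open>lt\<close>. The pieces need not
  be contained in \<open>X\<close>; as \<open>f\<close> is only meaningful on \<open>X\<close>, the upper bound is required on \<open>P i \<inter> X\<close>.\<close>

definition apx_PWS_oracle ::
    "'a::euclidean_space set \<Rightarrow> ('a \<Rightarrow> real) \<Rightarrow> nat \<Rightarrow> real \<Rightarrow> real \<Rightarrow> ('a \<Rightarrow> 'a \<Rightarrow> real) \<Rightarrow> bool" where
  "apx_PWS_oracle X f k L \<delta> lt \<longleftrightarrow> L \<ge> 0 \<and> \<delta> \<ge> 0 \<and>
     (\<exists>P :: nat \<Rightarrow> 'a set. X \<subseteq> (\<Union>i\<in>{1..k}. P i) \<and>
        (\<forall>z\<in>X. affine_fun (lt z) \<and> (\<forall>y\<in>X. f y \<ge> lt z y) \<and>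
           (\<forall>i\<in>{1..k}. z \<in> P i \<longrightarrow>
              (\<forall>y\<in>P i \<inter> X. f y - lt z y \<le> L / 2 * (norm (y - z))\<^sup>2 + \<delta>))))"

definition W_psi :: "('a::euclidean_space \<Rightarrow> real) \<Rightarrow> ('a \<Rightarrow> 'a) \<Rightarrow> ('a \<Rightarrow> 'a \<Rightarrow> real) \<Rightarrow> 'a \<Rightarrow>
    'a set \<Rightarrow> 'a \<Rightarrow> real" where
  "W_psi f g lt xbar S x = Max (insert (lin f g xbar x) ((\<lambda>z. lt z x) ` S))"

definition W_val :: "'a::euclidean_space set \<Rightarrow> ('a \<Rightarrow> real) \<Rightarrow> ('a \<Rightarrow> 'a) \<Rightarrow> ('a \<Rightarrow> 'a \<Rightarrow> real) \<Rightarrow> 'a \<Rightarrow>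
    'a set \<Rightarrow> real \<Rightarrow> real" where
  "W_val X f g lt xbar S \<iota> =
     1 / \<iota> * (SUP x\<in>{x\<in>X. norm (x - xbar) \<le> \<iota>}. W_psi f g lt xbar S xbar - W_psi f g lt xbar S x)"

definition W_certificate ::
    "'a::euclidean_space set \<Rightarrow> ('a \<Rightarrow> real) \<Rightarrow> ('a \<Rightarrow> 'a) \<Rightarrow> ('a \<Rightarrow> 'a \<Rightarrow> real) \<Rightarrow> 'a \<Rightarrow>
     'a set \<Rightarrow> real \<Rightarrow> real \<Rightarrow> bool" where
  "W_certificate X f g lt xbar S \<iota> \<nu> \<longleftrightarrow>
     finite S \<and> S \<subseteq> X \<and> \<iota> > 0 \<and> (\<forall>z\<in>S. norm (z - xbar) \<le> \<iota>) \<and>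
     W_val X f g lt xbar S \<iota> \<le> \<nu>"

text \<open>In the subroutine, \<open>search_pt \<dots> t\<close> is $x^t$ and \<open>level_set \<dots> t\<close> is $X(t)$. If the latter is
  empty, \<open>search_pt \<dots> (Suc t)\<close> is unspecified; the distance \<open>step_dist\<close> is then infinite and
  the subroutine stops without using that point.\<close>

function search_pt :: "'a::euclidean_space set \<Rightarrow> ('a \<Rightarrow> real) \<Rightarrow> ('a \<Rightarrow> 'a) \<Rightarrow>
      ('a \<Rightarrow> 'a \<Rightarrow> real) \<Rightarrow> 'a \<Rightarrow> real \<Rightarrow> nat \<Rightarrow> 'a"
  and level_set :: "'a::euclidean_space set \<Rightarrow> ('a \<Rightarrow> real) \<Rightarrow> ('a \<Rightarrow> 'a) \<Rightarrow>
      ('a \<Rightarrow> 'a \<Rightarrow> real) \<Rightarrow> 'a \<Rightarrow> real \<Rightarrow> nat \<Rightarrow> 'a set" where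
  "search_pt X f g lt xbar \<Delta> 0 = xbar"
| "search_pt X f g lt xbar \<Delta> (Suc t) =
     (ARG_MIN (\<lambda>x. (norm (x - xbar))\<^sup>2) x. x \<in> level_set X f g lt xbar \<Delta> t)"
| "level_set X f g lt xbar \<Delta> t =
     {x \<in> X. lin f g xbar x \<le> f xbar - 2 * \<Delta> \<and>
        (\<forall>i\<in>{1..t}. lt (search_pt X f g lt xbar \<Delta> i) x \<le> f xbar - 2 * \<Delta>)}"
  by pat_completeness auto
termination
  by (relation "Wellfounded.measure (\<lambda>s. case s of Inl (_, _, _, _, _, _, t) \<Rightarrow> 2 * t
                                      | Inr (_, _, _, _, _, _, t) \<Rightarrow> 2 * t + 1)") auto

definition step_dist :: "'a::euclidean_space set \<Rightarrow> ('a \<Rightarrow> real) \<Rightarrow> ('a \<Rightarrow> 'a) \<Rightarrow>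
    ('a \<Rightarrow> 'a \<Rightarrow> real) \<Rightarrow> 'a \<Rightarrow> real \<Rightarrow> nat \<Rightarrow> ereal" where
  "step_dist X f g lt xbar \<Delta> t =
     (if level_set X f g lt xbar \<Delta> t = {} then \<infinity>
      else ereal (norm (search_pt X f g lt xbar \<Delta> (Suc t) - xbar)))"

text \<open>The empirical smoothness constant is extended real: two search points may coincide, and then
  a positive numerator over \<open>0\<close> gives \<open>\<infinity>\<close>, a negative one \<open>-\<infinity>\<close> (and \<open>0 / 0 = 0\<close>); for \<open>m = 0\<close>
  there is no pair and the minimum is \<open>\<infinity>\<close>.\<close>

definition emp_smoothness :: "'a::euclidean_space set \<Rightarrow> ('a \<Rightarrow> real) \<Rightarrow> ('a \<Rightarrow> 'a) \<Rightarrow>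
    ('a \<Rightarrow> 'a \<Rightarrow> real) \<Rightarrow> 'a \<Rightarrow> real \<Rightarrow> nat \<Rightarrow> ereal" where
  "emp_smoothness X f g lt xbar \<Delta> m =
     (let x = search_pt X f g lt xbar \<Delta> in
      INF (l, r)\<in>{(l, r). 1 \<le> l \<and> l < r \<and> r \<le> m + 1}.
        ereal (2 * (f (x r) - lt (x l) (x r) - \<Delta> / 6)) / ereal ((norm (x l - x r))\<^sup>2))"

text \<open>The quantity $\frac12\sqrt{\Delta/\tilde L}$.\<close>

definition R3_threshold :: "real \<Rightarrow> ereal \<Rightarrow> ereal" where
  "R3_threshold \<Delta> Lt =
     (if Lt \<le> 0 then \<infinity> else if Lt = \<infinity> then 0
      else ereal (1 / 2 * sqrt (\<Delta> / real_of_ereal Lt)))"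

text \<open>\<open>Exit_R1 S \<iota> \<nu>\<close> and \<open>Exit_R4 S \<iota> \<nu>\<close> return the points \<open>S\<close> as an $(\iota,\nu)$-certificate,
  \<open>Exit_R3\<close> returns False. \<open>Exit_R2 S\<close> returns \<open>S\<close> as a certificate with an infinite radius, that is, as
  an $(M, 2\Delta/M)$-certificate for arbitrarily large $M$, so no particular $M$ is recorded.\<close>

datatype 'a search_result =
    Exit_R1 "'a set" real real
  | Exit_R2 "'a set"
  | Exit_R3
  | Exit_R4 "'a set" real real

definition W_search :: "'a::euclidean_space set \<Rightarrow> ('a \<Rightarrow> real) \<Rightarrow> ('a \<Rightarrow> 'a) \<Rightarrow>
    ('a \<Rightarrow> 'a \<Rightarrow> real) \<Rightarrow> 'a \<Rightarrow> real \<Rightarrow> nat \<Rightarrow> ereal \<Rightarrow> 'a search_result" where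
  "W_search X f g lt xbar \<Delta> m \<iota>max =
     (let x = search_pt X f g lt xbar \<Delta>;
          d = step_dist X f g lt xbar \<Delta>;
          stop = (\<lambda>t. d t > \<iota>max \<or> d t = \<infinity>)
      in if \<exists>t\<le>m. stop t then
           let t = (LEAST t. stop t) in
           if d t > \<iota>max
           then Exit_R1 (x ` {0..t}) (real_of_ereal \<iota>max) (2 * \<Delta> / real_of_ereal \<iota>max)
           else Exit_R2 (x ` {0..t})
         else
           let \<iota> = norm (xbar - x (m + 1)) in
           if ereal \<iota> < R3_threshold \<Delta> (emp_smoothness X f g lt xbar \<Delta> m)
           then Exit_R3
           else Exit_R4 (x ` {0..m}) \<iota> (2 * \<Delta> / \<iota>))"

end

theory Submission
  imports Defs
begin

text \<open>Let \<open>\<psi>\<close> be the maximum of the linearizations collected so far. It minorizes \<open>f\<close>, agrees with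
  \<open>f\<close> at the centre \<open>xbar\<close>, and exceeds the level \<open>f xbar - 2\<Delta>\<close> at every feasible point outside the
  current level set. Everything rests on three observations.

  First, the search points are the successive projections of \<open>xbar\<close> onto nested closed convex sets.
  Hence their distances to \<open>xbar\<close> increase, no feasible point closer to \<open>xbar\<close> than the last search
  point lies in the last level set, and so \<open>\<psi>\<close> decreases by at most \<open>2\<Delta>\<close> over the ball that the last
  point determines (over all of \<open>X\<close> if the level set is empty). That is the certificate. Moreover, by
  the obtuse angle property of projections, any two search points are no farther apart than the last
  one is from \<open>xbar\<close> (\<open>search_pt_gap_le\<close>).

  Second, as \<open>\<psi>\<close> is convex with \<open>\<psi> xbar = f xbar\<close> and \<open>\<psi> \<le> f\<close>, a certificate \<open>(\<iota>, \<nu>)\<close> limits the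
  decrease towards a minimizer at distance \<open>d\<close> to \<open>max \<iota> d * \<nu>\<close>. Combined with quadratic growth this
  bounds the optimality gap by \<open>max (\<iota> * \<nu>) (2 * \<nu>\<^sup>2 / \<mu>)\<close> (\<open>W_certificate_gap\<close>).

  Third, the last test of the subroutine compares the empirical smoothness constant with
  \<open>\<Delta> / (4 * \<iota>\<^sup>2)\<close> (\<open>less_R3_threshold_iff\<close>). If the gap at \<open>xbar\<close> is at most \<open>\<Delta>\<close>, then at a search
  point \<open>f\<close> exceeds each earlier linearization by at least \<open>\<Delta>\<close>, while the two points are at most \<open>\<iota>\<close>
  apart; this makes the constant too large for the test to reject. If the test is passed, then with
  \<open>\<nu> = 2 * \<Delta> / \<iota>\<close> the term \<open>2 * \<nu>\<^sup>2 / \<mu>\<close> is at most \<open>32 * Lt / \<mu> * \<Delta>\<close>, where \<open>Lt\<close> is the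
  empirical constant. Finally, with more points than pieces, two points share a piece, and the
  upper bound on that piece shows that the empirical constant is at most \<open>L\<close>.\<close>

section \<open>Minimal values and affine functions\<close>

lemma min_val_eq:
  assumes "y \<in> minimizers X f"
  shows "min_val X f = f y"
  using assms unfolding min_val_def minimizers_def
  by (intro cInf_eq_minimum) auto

lemma min_val_le:
  assumes "minimizers X f \<noteq> {}" and "y \<in> X"
  shows "min_val X f \<le> f y"
proof -
  obtain z where "z \<in> minimizers X f" using assms(1) by blast
  with assms(2) show ?thesis by (simp add: min_val_eq) (simp add: minimizers_def)
qed

lemma closed_minimizers:
  fixes f :: "'a::euclidean_space \<Rightarrow> real"
  assumes "closed X" and "continuous_on X f"
  shows "closed (minimizers X f)"
proof (cases "minimizers X f = {}")
  case False
  then obtain z where z: "z \<in> minimizers X f" by blast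
  have "minimizers X f = X \<inter> f -` {..f z}"
    using z by (fastforce simp: minimizers_def)
  then show ?thesis using continuous_closed_preimage[OF assms(2,1)] by simp
qed simp

lemma affine_fun_segment:
  assumes "affine_fun h"
  shows "h (z + s *\<^sub>R (y - z)) = (1 - s) * h z + s * h y"
proof -
  obtain a c where h: "\<And>y. h y = a \<bullet> y + c" using assms by (auto simp: affine_fun_def)
  show ?thesis by (simp add: h inner_simps algebra_simps)
qed

lemma closed_convex_affine_sublevel:
  assumes "affine_fun h"
  shows "closed {y. h y \<le> c}" and "convex {y. h y \<le> c}"
proof -
  obtain a b where h: "\<And>y. h y = a \<bullet> y + b" using assms by (auto simp: affine_fun_def)
  have "{y. h y \<le> c} = {y. a \<bullet> y \<le> c - b}" by (auto simp: h)
  then show "closed {y. h y \<le> c}" and "convex {y. h y \<le> c}"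
    by (simp_all add: closed_halfspace_le convex_halfspace_le)
qed

lemma affine_fun_lin: "affine_fun (lin f g z)"
proof -
  have "lin f g z y = g z \<bullet> y + (f z - g z \<bullet> z)" for y by (simp add: lin_def inner_diff_right)
  then show ?thesis unfolding affine_fun_def by blast
qed

lemma lin_self [simp]: "lin f g z z = f z"
  by (simp add: lin_def)

section \<open>What a certificate implies\<close>

locale cutting_plane_model =
  fixes X :: "'a::euclidean_space set" and f :: "'a \<Rightarrow> real" and g :: "'a \<Rightarrow> 'a"
    and lt :: "'a \<Rightarrow> 'a \<Rightarrow> real" and xbar :: 'a
  assumes convex_X: "convex X" and xbar_in: "xbar \<in> X"
    and subgradient_xbar: "is_subgradient X f xbar (g xbar)"
    and affine_lt: "\<And>z. z \<in> X \<Longrightarrow> affine_fun (lt z)"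
    and lt_le: "\<And>z y. z \<in> X \<Longrightarrow> y \<in> X \<Longrightarrow> lt z y \<le> f y"
begin

lemma lin_xbar_le: "y \<in> X \<Longrightarrow> lin f g xbar y \<le> f y"
  using subgradient_xbar by (simp add: is_subgradient_def lin_def)

abbreviation \<psi> :: "'a set \<Rightarrow> 'a \<Rightarrow> real" where
  "\<psi> \<equiv> W_psi f g lt xbar"

lemma lin_le_psi: "finite S \<Longrightarrow> lin f g xbar y \<le> \<psi> S y"
  by (simp add: W_psi_def)

lemma lt_le_psi: "finite S \<Longrightarrow> z \<in> S \<Longrightarrow> lt z y \<le> \<psi> S y"
  by (simp add: W_psi_def)

lemma psi_le_iff: "finite S \<Longrightarrow> \<psi> S y \<le> c \<longleftrightarrow> lin f g xbar y \<le> c \<and> (\<forall>z\<in>S. lt z y \<le> c)"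
  by (simp add: W_psi_def)

lemma psi_le: "finite S \<Longrightarrow> S \<subseteq> X \<Longrightarrow> y \<in> X \<Longrightarrow> \<psi> S y \<le> f y"
  using lin_xbar_le lt_le by (auto simp: psi_le_iff)

lemma psi_xbar: "finite S \<Longrightarrow> S \<subseteq> X \<Longrightarrow> \<psi> S xbar = f xbar"
  using psi_le[of S xbar] lin_le_psi[of S xbar] xbar_in by force

lemma psi_segment_le:
  assumes "finite S" "S \<subseteq> X" "0 \<le> s" "s \<le> 1"
  shows "\<psi> S (xbar + s *\<^sub>R (y - xbar)) \<le> (1 - s) * f xbar + s * \<psi> S y"
proof -
  have "h (xbar + s *\<^sub>R (y - xbar)) \<le> (1 - s) * f xbar + s * \<psi> S y"
    if "affine_fun h" "h xbar \<le> f xbar" "h y \<le> \<psi> S y" for h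
    using that assms(3,4) by (simp add: affine_fun_segment add_mono mult_left_mono)
  moreover have "affine_fun (lt z)" "lt z xbar \<le> f xbar" "lt z y \<le> \<psi> S y" if "z \<in> S" for z
    using that assms(1,2) affine_lt lt_le xbar_in lt_le_psi by auto
  ultimately show ?thesis
    using assms(1) affine_fun_lin[of f g xbar] lin_le_psi[OF assms(1)] by (simp add: psi_le_iff)
qed

lemma segment_in_X:
  assumes "y \<in> X" "0 \<le> s" "s \<le> 1"
  shows "xbar + s *\<^sub>R (y - xbar) \<in> X"
proof -
  have "xbar + s *\<^sub>R (y - xbar) = (1 - s) *\<^sub>R xbar + s *\<^sub>R y" by (simp add: algebra_simps)
  then show ?thesis using assms convexD_alt[OF convex_X xbar_in] by simp
qed

lemma W_certificateI:
  assumes "finite S" "S \<subseteq> X" "\<iota> > 0" "\<And>z. z \<in> S \<Longrightarrow> norm (z - xbar) \<le> \<iota>"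
    and dec: "\<And>y. y \<in> X \<Longrightarrow> norm (y - xbar) \<le> \<iota> \<Longrightarrow> f xbar - c \<le> \<psi> S y"
  shows "W_certificate X f g lt xbar S \<iota> (c / \<iota>)"
proof -
  have "(SUP y\<in>{y\<in>X. norm (y - xbar) \<le> \<iota>}. \<psi> S xbar - \<psi> S y) \<le> c"
  proof (rule cSUP_least)
    show "{y\<in>X. norm (y - xbar) \<le> \<iota>} \<noteq> {}"
      using xbar_in assms(3) by (auto intro!: exI[of _ xbar])
    show "\<psi> S xbar - \<psi> S y \<le> c" if "y \<in> {y\<in>X. norm (y - xbar) \<le> \<iota>}" for y
      using dec[of y] that psi_xbar[OF assms(1,2)] by auto
  qed
  then have "W_val X f g lt xbar S \<iota> \<le> c / \<iota>"
    using assms(3) by (simp add: W_val_def divide_right_mono)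
  then show ?thesis using assms by (simp add: W_certificate_def)
qed

text \<open>Reading the bound off the supremum needs the decrease of the model to be bounded over the
  ball; the linearization at the centre provides this, its slope being \<open>g xbar\<close>.\<close>

lemma W_certificate_decrease:
  assumes cert: "W_certificate X f g lt xbar S \<iota> \<nu>" and y: "y \<in> X" "norm (y - xbar) \<le> \<iota>"
  shows "f xbar - \<iota> * \<nu> \<le> \<psi> S y"
proof -
  note S = cert[unfolded W_certificate_def]
  let ?B = "{y\<in>X. norm (y - xbar) \<le> \<iota>}" and ?D = "\<lambda>y. \<psi> S xbar - \<psi> S y"
  have "?D z \<le> norm (g xbar) * \<iota>" if "z \<in> ?B" for z
  proof -
    have "\<bar>g xbar \<bullet> (z - xbar)\<bar> \<le> norm (g xbar) * \<iota>"
      using that by (intro order_trans[OF Cauchy_Schwarz_ineq2] mult_left_mono) auto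
    moreover have "lin f g xbar z \<le> \<psi> S z" using S by (simp add: lin_le_psi)
    ultimately show ?thesis using S psi_xbar by (simp add: lin_def)
  qed
  then have "bdd_above (?D ` ?B)" by (rule bdd_aboveI2)
  then have "?D y \<le> (SUP y\<in>?B. ?D y)" using y by (intro cSUP_upper) auto
  moreover have "(SUP y\<in>?B. ?D y) \<le> \<iota> * \<nu>"
    using S by (auto simp: W_val_def pos_divide_le_eq mult.commute)
  ultimately show ?thesis using S psi_xbar by simp
qed

text \<open>If the target lies outside the ball, shrink the step towards it until it has length \<open>\<iota>\<close>; by
  convexity the model loses along the whole segment at most \<open>norm (y - xbar) / \<iota>\<close> times as much.\<close>

lemma W_certificate_global_decrease:
  assumes cert: "W_certificate X f g lt xbar S \<iota> \<nu>" and y: "y \<in> X"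
  shows "f xbar - f y \<le> max \<iota> (norm (y - xbar)) * \<nu>"
proof -
  note S = cert[unfolded W_certificate_def]
  have psi_y: "\<psi> S y \<le> f y" using S y psi_le by blast
  show ?thesis
  proof (cases "norm (y - xbar) \<le> \<iota>")
    case True
    then show ?thesis using W_certificate_decrease[OF cert y] psi_y by (simp add: max_def)
  next
    case False
    define s where "s = \<iota> / norm (y - xbar)"
    have s: "0 < s" "s \<le> 1" "s * norm (y - xbar) = \<iota>"
      using S False by (auto simp: s_def divide_simps)
    have "f xbar - \<iota> * \<nu> \<le> \<psi> S (xbar + s *\<^sub>R (y - xbar))"
      using s y by (intro W_certificate_decrease[OF cert] segment_in_X) auto
    also have "\<dots> \<le> (1 - s) * f xbar + s * \<psi> S y"
      using S s by (intro psi_segment_le) auto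
    also have "\<dots> \<le> (1 - s) * f xbar + s * f y"
      using psi_y s by simp
    finally have "s * (f xbar - f y) \<le> s * (norm (y - xbar) * \<nu>)"
      using s(3) by (simp add: algebra_simps flip: mult.assoc)
    then show ?thesis using s(1) False by simp
  qed
qed

text \<open>With \<open>d\<close> the distance to the nearest minimizer, the linear upper bound \<open>d * \<nu>\<close> on the gap and
  the quadratic lower bound \<open>\<mu> / 2 * d\<^sup>2\<close> together force \<open>d \<le> 2 * \<nu> / \<mu>\<close>.\<close>

lemma W_certificate_gap:
  assumes cert: "W_certificate X f g lt xbar S \<iota> \<nu>"
    and "closed X" "continuous_on X f" and ne: "minimizers X f \<noteq> {}"
    and growth: "quadratic_growth X f \<mu>" "\<mu> > 0"
  shows "f xbar - min_val X f \<le> max (\<iota> * \<nu>) (2 * \<nu>\<^sup>2 / \<mu>)"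
proof -
  have "closed (minimizers X f)" using assms closed_minimizers by blast
  then obtain y where y: "y \<in> minimizers X f" "infdist xbar (minimizers X f) = dist xbar y"
    using infdist_attains_inf[OF _ ne] by metis
  define d where "d = norm (y - xbar)"
  have "y \<in> X" using y by (simp add: minimizers_def)
  then have gap: "f xbar - min_val X f \<le> max \<iota> d * \<nu>"
    using W_certificate_global_decrease[OF cert] min_val_eq[OF y(1)] by (simp add: d_def)
  show ?thesis
  proof (cases "d \<le> \<iota>")
    case True
    then show ?thesis using gap by (simp add: max_def split: if_splits)
  next
    case False
    have "\<iota> > 0" using cert by (simp add: W_certificate_def)
    then have d: "0 < d" using False by simp
    have gap: "f xbar - min_val X f \<le> d * \<nu>" using gap False by simp
    have "\<mu> / 2 * d\<^sup>2 \<le> f xbar - min_val X f"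
      using growth xbar_in y(2) unfolding quadratic_growth_def
      by (metis d_def dist_norm norm_minus_commute)
    then have "d * (\<mu> / 2 * d) \<le> d * \<nu>"
      using gap by (simp add: power2_eq_square algebra_simps)
    then have le: "\<mu> / 2 * d \<le> \<nu>" using d mult_le_cancel_left_pos by blast
    then have "0 \<le> \<nu>" using growth(2) d by (smt (verit) mult_pos_pos half_gt_zero)
    moreover have "d \<le> 2 * \<nu> / \<mu>" using le growth(2) by (simp add: field_simps)
    ultimately have "d * \<nu> \<le> 2 * \<nu> / \<mu> * \<nu>" by (intro mult_right_mono)
    then show ?thesis using gap by (simp add: power2_eq_square algebra_simps)
  qed
qed

end

section \<open>The search points\<close>

text \<open>The equation for the level sets rewrites every occurrence, so the simplifier would expand the
  whole recursion.\<close>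

declare level_set.simps [simp del] search_pt.simps(2) [simp del]

locale level_search = cutting_plane_model +
  fixes \<Delta> :: real
  assumes closed_X: "closed X" and Delta_pos: "\<Delta> > 0"
begin

abbreviation x :: "nat \<Rightarrow> 'a" where
  "x \<equiv> search_pt X f g lt xbar \<Delta>"

abbreviation Xl :: "nat \<Rightarrow> 'a set" where
  "Xl \<equiv> level_set X f g lt xbar \<Delta>"

lemma in_Xl_iff:
  "y \<in> Xl t \<longleftrightarrow> y \<in> X \<and> lin f g xbar y \<le> f xbar - 2 * \<Delta> \<and>
     (\<forall>i\<in>{1..t}. lt (x i) y \<le> f xbar - 2 * \<Delta>)"
  by (simp add: level_set.simps)

lemma Xl_antimono: "s \<le> t \<Longrightarrow> Xl t \<subseteq> Xl s"
  by (auto simp: in_Xl_iff)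

lemma closed_convex_Xl:
  assumes "\<And>i. i \<in> {1..t} \<Longrightarrow> x i \<in> X"
  shows "closed (Xl t)" and "convex (Xl t)"
proof -
  have "Xl t = X \<inter> {y. lin f g xbar y \<le> f xbar - 2 * \<Delta>} \<inter>
      (\<Inter>i\<in>{1..t}. {y. lt (x i) y \<le> f xbar - 2 * \<Delta>})"
    by (auto simp: in_Xl_iff)
  then show "closed (Xl t)" and "convex (Xl t)"
    using closed_X convex_X assms
    by (auto intro!: closed_Int closed_INT convex_Int convex_INT closed_convex_affine_sublevel
        affine_fun_lin affine_lt)
qed

lemma search_pt_Suc_nearest:
  assumes "closed (Xl t)" and "Xl t \<noteq> {}"
  shows "x (Suc t) \<in> Xl t" and "\<And>y. y \<in> Xl t \<Longrightarrow> norm (x (Suc t) - xbar) \<le> norm (y - xbar)"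
proof -
  obtain z where z: "z \<in> Xl t" "\<And>y. y \<in> Xl t \<Longrightarrow> dist xbar z \<le> dist xbar y"
    using distance_attains_inf[OF assms] by metis
  have "is_arg_min (\<lambda>y. (norm (y - xbar))\<^sup>2) (\<lambda>y. y \<in> Xl t) z"
    using z by (simp add: is_arg_min_linorder power_mono dist_norm norm_minus_commute)
  then have "is_arg_min (\<lambda>y. (norm (y - xbar))\<^sup>2) (\<lambda>y. y \<in> Xl t) (x (Suc t))"
    unfolding search_pt.simps arg_min_def by (rule someI)
  then show "x (Suc t) \<in> Xl t" and "\<And>y. y \<in> Xl t \<Longrightarrow> norm (x (Suc t) - xbar) \<le> norm (y - xbar)"
    by (auto simp: is_arg_min_linorder)
qed

lemma search_pt_in_X:
  assumes "\<And>s. s < t \<Longrightarrow> Xl s \<noteq> {}"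
  shows "i \<le> t \<Longrightarrow> x i \<in> X"
proof (induction i rule: less_induct)
  case (less i)
  show ?case
  proof (cases i)
    case 0
    then show ?thesis by (simp add: xbar_in)
  next
    case (Suc j)
    have "closed (Xl j)" using less Suc by (intro closed_convex_Xl) auto
    then have "x (Suc j) \<in> Xl j" using less.prems Suc assms by (intro search_pt_Suc_nearest) auto
    then show ?thesis using Suc by (simp add: in_Xl_iff)
  qed
qed

lemma psi_gt_outside_Xl:
  assumes "y \<in> X" "y \<notin> Xl t"
  shows "f xbar - 2 * \<Delta> < \<psi> (x ` {0..t}) y"
  using assms lin_le_psi[of "x ` {0..t}" y] lt_le_psi[of "x ` {0..t}" _ y]
  by (fastforce simp: in_Xl_iff not_le)

text \<open>An empty level set means that the model stays above the level on all of \<open>X\<close>, whatever the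
  radius, provided that the ball contains the points of the certificate.\<close>

lemma W_certificate_of_empty_Xl:
  assumes ne: "\<And>s. s < t \<Longrightarrow> Xl s \<noteq> {}" and "Xl t = {}"
  shows "\<forall>\<^sub>F M in at_top. W_certificate X f g lt xbar (x ` {0..t}) M (2 * \<Delta> / M)"
proof -
  have bound: "\<forall>\<^sub>F M in at_top. \<forall>z\<in>x ` {0..t}. norm (z - xbar) \<le> M"
    by (intro eventually_ball_finite ballI eventually_ge_at_top) auto
  show ?thesis
    using eventually_gt_at_top[of 0] bound
  proof eventually_elim
    case (elim M)
    show ?case
    proof (rule W_certificateI)
      show "x ` {0..t} \<subseteq> X" using search_pt_in_X[OF ne] by auto
      show "f xbar - 2 * \<Delta> \<le> \<psi> (x ` {0..t}) y" if "y \<in> X" for y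
        using psi_gt_outside_Xl[OF that, of t] assms(2) by simp
    qed (use elim in auto)
  qed
qed

text \<open>As the certificate holds for every large radius, it reaches the minimizers.\<close>

lemma gap_le_of_certificates_at_top:
  assumes cert: "\<forall>\<^sub>F M in at_top. W_certificate X f g lt xbar S M (2 * \<Delta> / M)"
    and "minimizers X f \<noteq> {}"
  shows "f xbar - min_val X f \<le> 2 * \<Delta>"
proof -
  obtain y where y: "y \<in> minimizers X f" using assms(2) by blast
  then have "y \<in> X" by (simp add: minimizers_def)
  have "\<forall>\<^sub>F M in at_top. W_certificate X f g lt xbar S M (2 * \<Delta> / M) \<and> 0 < M \<and>
      norm (y - xbar) \<le> M"
    by (intro eventually_conj cert eventually_gt_at_top eventually_ge_at_top)
  then obtain M where M: "W_certificate X f g lt xbar S M (2 * \<Delta> / M)" "0 < M"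
      "norm (y - xbar) \<le> M"
    using eventually_happens trivial_limit_at_top_linorder by blast
  have "f xbar - f y \<le> M * (2 * \<Delta> / M)"
    using W_certificate_global_decrease[OF M(1) \<open>y \<in> X\<close>] M(3) by (simp add: max_absorb1)
  then show ?thesis using min_val_eq[OF y] M(2) by simp
qed

end

section \<open>Runs that never meet an empty level set\<close>

locale complete_level_search = level_search +
  fixes m :: nat
  assumes Xl_ne: "\<And>s. s \<le> m \<Longrightarrow> Xl s \<noteq> {}"
begin

abbreviation \<iota> :: real where
  "\<iota> \<equiv> norm (xbar - x (m + 1))"

lemma x_in_X: "i \<le> m + 1 \<Longrightarrow> x i \<in> X"
  using search_pt_in_X[of "m + 1" i] Xl_ne by simp

lemma Xl_closed_convex:
  assumes "t \<le> m"
  shows "closed (Xl t)" and "convex (Xl t)"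
  using closed_convex_Xl[of t] x_in_X assms by auto

lemma x_Suc_in_Xl: "t \<le> m \<Longrightarrow> x (Suc t) \<in> Xl t"
  using search_pt_Suc_nearest Xl_closed_convex Xl_ne by blast

lemma x_Suc_nearest: "t \<le> m \<Longrightarrow> y \<in> Xl t \<Longrightarrow> norm (x (Suc t) - xbar) \<le> norm (y - xbar)"
  using search_pt_Suc_nearest(2) Xl_closed_convex Xl_ne by blast

lemma x_in_earlier_Xl:
  assumes "t < r" "r \<le> m + 1"
  shows "x r \<in> Xl t"
proof -
  obtain j where "r = Suc j" "t \<le> j" "j \<le> m" using assms by (cases r) auto
  then show ?thesis using x_Suc_in_Xl Xl_antimono by blast
qed

lemma norm_x_le:
  assumes "i \<le> m + 1"
  shows "norm (x i - xbar) \<le> \<iota>"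
proof (cases i)
  case (Suc j)
  have "norm (x (Suc j) - xbar) \<le> norm (x (m + 1) - xbar)"
    using assms Suc by (intro x_Suc_nearest x_in_earlier_Xl) auto
  then show ?thesis using Suc by (simp add: norm_minus_commute)
qed simp

text \<open>The linearization at \<open>xbar\<close> is \<open>f xbar\<close> there, but at most \<open>f xbar - 2 * \<Delta>\<close> on the level set.\<close>

lemma radius_pos: "\<iota> > 0"
  using x_Suc_in_Xl[of m] Delta_pos by (auto simp: in_Xl_iff)

text \<open>The later point \<open>x r\<close> belongs to the convex set onto which \<open>xbar\<close> was projected to give
  \<open>x l\<close>, so the triangle \<open>xbar\<close>, \<open>x l\<close>, \<open>x r\<close> has an angle of at least a right angle at \<open>x l\<close>, and
  its longest side is the one from \<open>xbar\<close> to \<open>x r\<close>, whose length is at most \<open>\<iota>\<close>.\<close>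

lemma search_pt_gap_le:
  assumes "1 \<le> l" "l < r" "r \<le> m + 1"
  shows "norm (x l - x r) \<le> \<iota>"
proof -
  obtain j where l: "l = Suc j" using assms(1) by (cases l) auto
  have j: "j \<le> m" using assms l by simp
  have "(xbar - x l) \<bullet> (x r - x l) \<le> 0"
    unfolding l
  proof (rule any_closest_point_dot[OF Xl_closed_convex(2,1)[OF j] x_Suc_in_Xl[OF j]])
    show "x r \<in> Xl j" using assms l by (intro x_in_earlier_Xl) auto
    show "\<forall>z\<in>Xl j. dist xbar (x (Suc j)) \<le> dist xbar z"
      using x_Suc_nearest[OF j] by (simp add: dist_norm norm_minus_commute)
  qed
  then have "norm (x r - x l) \<le> norm (x r - xbar)"
    by (simp add: norm_le inner_simps algebra_simps inner_commute)
      (smt (verit) inner_ge_zero inner_diff_left inner_diff_right inner_commute)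
  also have "\<dots> \<le> \<iota>" using assms by (intro norm_x_le)
  finally show ?thesis by (simp add: norm_minus_commute)
qed

text \<open>Feasible points closer to \<open>xbar\<close> than \<open>\<iota>\<close> lie outside the last level set. A point \<open>y\<close> on the
  sphere of radius \<open>\<iota>\<close> may lie in it; there the bound follows by passing to the limit along the
  segment from \<open>xbar\<close>, on which the model at parameter \<open>s < 1\<close> is above the level and at most
  \<open>(1 - s) * f xbar + s * \<psi> y\<close>.\<close>

lemma psi_ge_on_ball:
  assumes y: "y \<in> X" "norm (y - xbar) \<le> \<iota>"
  shows "f xbar - 2 * \<Delta> \<le> \<psi> (x ` {0..m}) y"
proof -
  let ?S = "x ` {0..m}"
  have S: "?S \<subseteq> X" using x_in_X by auto
  have less: "f xbar - 2 * \<Delta> \<le> (1 - s) * f xbar + s * \<psi> ?S y" if s: "0 \<le> s" "s < 1" for s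
  proof -
    let ?z = "xbar + s *\<^sub>R (y - xbar)"
    have "norm (?z - xbar) = s * norm (y - xbar)" using s by simp
    also have "\<dots> \<le> s * \<iota>" using y(2) s by (intro mult_left_mono) auto
    also have "\<dots> < \<iota>" using s radius_pos by simp
    finally have "?z \<notin> Xl m" using x_Suc_nearest[of m ?z] by (auto simp: norm_minus_commute)
    then have "f xbar - 2 * \<Delta> \<le> \<psi> ?S ?z"
      using psi_gt_outside_Xl[of ?z m] segment_in_X[OF y(1)] s by force
    also have "\<dots> \<le> (1 - s) * f xbar + s * \<psi> ?S y"
      using s S by (intro psi_segment_le) auto
    finally show ?thesis .
  qed
  have "((\<lambda>s. (1 - s) * f xbar + s * \<psi> ?S y) \<longlongrightarrow> (1 - 1) * f xbar + 1 * \<psi> ?S y) (at_left 1)"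
    by (intro tendsto_intros)
  moreover have "\<forall>\<^sub>F s in at_left 1. f xbar - 2 * \<Delta> \<le> (1 - s) * f xbar + s * \<psi> ?S y"
    using eventually_at_left_real[of 0 1] by (rule eventually_mono) (auto intro: less)
  ultimately have "f xbar - 2 * \<Delta> \<le> (1 - 1) * f xbar + 1 * \<psi> ?S y"
    by (rule tendsto_lowerbound) simp
  then show ?thesis by simp
qed

lemma W_certificate_last: "W_certificate X f g lt xbar (x ` {0..m}) \<iota> (2 * \<Delta> / \<iota>)"
  using x_in_X norm_x_le radius_pos psi_ge_on_ball by (intro W_certificateI) auto

section \<open>The empirical smoothness constant\<close>

text \<open>An earlier linearization is at most \<open>f xbar - 2 * \<Delta>\<close> at a later search point, where \<open>f\<close> itself is
  at least \<open>f xbar - \<Delta>\<close>; subtracting \<open>\<Delta> / 6\<close> from this difference leaves \<open>5 / 6 * \<Delta>\<close>.\<close>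

lemma emp_smoothness_ge:
  assumes low: "\<And>y. y \<in> X \<Longrightarrow> f xbar - \<Delta> \<le> f y"
  shows "ereal (5 * \<Delta> / (3 * \<iota>\<^sup>2)) \<le> emp_smoothness X f g lt xbar \<Delta> m"
  unfolding emp_smoothness_def Let_def
proof (rule INF_greatest, clarify)
  fix l r assume lr: "1 \<le> l" "l < r" "r \<le> m + 1"
  define n where "n = 2 * (f (x r) - lt (x l) (x r) - \<Delta> / 6)"
  define d where "d = norm (x l - x r)"
  have "x r \<in> Xl (r - 1)" using lr by (intro x_in_earlier_Xl) auto
  then have "lt (x l) (x r) \<le> f xbar - 2 * \<Delta>" using lr by (auto simp: in_Xl_iff)
  moreover have "f xbar - \<Delta> \<le> f (x r)" using lr x_in_X low by simp
  ultimately have n: "5 * \<Delta> / 3 \<le> n" by (simp add: n_def)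
  then have n_pos: "0 < n" using Delta_pos by linarith
  have "ereal (5 * \<Delta> / (3 * \<iota>\<^sup>2)) \<le> ereal n / ereal (d\<^sup>2)"
  proof (cases "d = 0")
    case True
    then show ?thesis using n_pos by (simp add: divide_ereal_def)
  next
    case False
    then have d: "0 < d" by (simp add: d_def)
    have "d \<le> \<iota>" unfolding d_def using lr by (rule search_pt_gap_le)
    then have "(5 * \<Delta> / 3) / \<iota>\<^sup>2 \<le> n / d\<^sup>2"
      using n n_pos d by (intro frac_le power_mono) auto
    then show ?thesis using d by simp
  qed
  then show "ereal (5 * \<Delta> / (3 * \<iota>\<^sup>2)) \<le>
      ereal (2 * (f (x r) - lt (x l) (x r) - \<Delta> / 6)) / ereal ((norm (x l - x r))\<^sup>2)"
    by (simp add: n_def d_def)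
qed

text \<open>Among \<open>m + 1 > k\<close> search points two lie in one piece. If they coincide, the numerator of
  their quotient is at most \<open>0\<close>, and so is the extended real quotient.\<close>

lemma emp_smoothness_le:
  assumes pws: "apx_PWS_oracle X f k L \<delta> lt" and "\<delta> \<le> \<Delta> / 6" "k \<le> m"
  shows "emp_smoothness X f g lt xbar \<Delta> m \<le> ereal L"
proof -
  obtain P :: "nat \<Rightarrow> 'a set" where L: "0 \<le> L" and cover: "X \<subseteq> (\<Union>i\<in>{1..k}. P i)"
    and upper: "\<And>z i y. \<lbrakk>z \<in> X; i \<in> {1..k}; z \<in> P i; y \<in> P i \<inter> X\<rbrakk> \<Longrightarrow>
      f y - lt z y \<le> L / 2 * (norm (y - z))\<^sup>2 + \<delta>"
    using pws unfolding apx_PWS_oracle_def by metis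
  have "\<exists>i\<in>{1..k}. x j \<in> P i" if "j \<in> {1..m + 1}" for j
    using that x_in_X[of j] cover by auto
  then obtain c where c: "\<And>j. j \<in> {1..m + 1} \<Longrightarrow> c j \<in> {1..k} \<and> x j \<in> P (c j)" by metis
  have "card (c ` {1..m + 1}) \<le> card {1..k}" using c by (intro card_mono) auto
  then have "\<not> inj_on c {1..m + 1}" using assms(3) by (intro pigeonhole) simp
  then obtain l r where lr: "1 \<le> l" "l < r" "r \<le> m + 1" "c l = c r"
    unfolding inj_on_def by (metis atLeastAtMost_iff nat_neq_iff)
  define n where "n = 2 * (f (x r) - lt (x l) (x r) - \<Delta> / 6)"
  define d where "d = norm (x l - x r)"
  have "f (x r) - lt (x l) (x r) \<le> L / 2 * (norm (x r - x l))\<^sup>2 + \<delta>"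
    using lr c[of l] c[of r] x_in_X by (intro upper[of _ "c l"]) auto
  then have n: "n \<le> L * d\<^sup>2" using assms(2) by (simp add: n_def d_def norm_minus_commute)
  have "emp_smoothness X f g lt xbar \<Delta> m \<le> ereal n / ereal (d\<^sup>2)"
    unfolding emp_smoothness_def Let_def n_def d_def using lr
    by (intro INF_lower2[of "(l, r)"]) auto
  also have "\<dots> \<le> ereal L"
  proof (cases "d = 0")
    case True
    then show ?thesis using n L by (cases "n = 0") (auto simp: divide_ereal_def)
  next
    case False
    then show ?thesis using n by (simp add: d_def field_simps)
  qed
  finally show ?thesis .
qed

end

text \<open>In real arithmetic this is squaring; the conventions for \<open>Lt \<le> 0\<close> and \<open>Lt = \<infinity>\<close> agree with it,
  so the test becomes a plain comparison with the extended real constant.\<close>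

lemma less_R3_threshold_iff:
  assumes "\<Delta> > 0" "\<iota> > 0"
  shows "ereal \<iota> < R3_threshold \<Delta> Lt \<longleftrightarrow> Lt < ereal (\<Delta> / (4 * \<iota>\<^sup>2))"
proof (cases Lt)
  case (real r)
  show ?thesis
  proof (cases "r \<le> 0")
    case True
    moreover have "0 < \<Delta> / (4 * \<iota>\<^sup>2)" using assms by simp
    ultimately show ?thesis using real by (simp add: R3_threshold_def)
  next
    case False
    have "sqrt ((2 * \<iota>)\<^sup>2) = 2 * \<iota>" using assms by (subst real_sqrt_abs) simp
    then have "\<iota> < 1 / 2 * sqrt (\<Delta> / r) \<longleftrightarrow> sqrt ((2 * \<iota>)\<^sup>2) < sqrt (\<Delta> / r)" by linarith
    also have "\<dots> \<longleftrightarrow> r < \<Delta> / (4 * \<iota>\<^sup>2)"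
      using assms False by (simp add: real_sqrt_less_iff field_simps power2_eq_square)
    finally show ?thesis using real False by (simp add: R3_threshold_def)
  qed
qed (use assms in \<open>auto simp: R3_threshold_def\<close>)

section \<open>The exits of the subroutine\<close>

text \<open>No distance exceeds an infinite radius, so the loop is left early only on an empty level set.\<close>

lemma W_search_infinite_radius:
  "W_search X f g lt xbar \<Delta> m \<infinity> =
     (if \<exists>t\<le>m. level_set X f g lt xbar \<Delta> t = {}
      then Exit_R2 (search_pt X f g lt xbar \<Delta> ` {0..LEAST t. level_set X f g lt xbar \<Delta> t = {}})
      else let \<iota> = norm (xbar - search_pt X f g lt xbar \<Delta> (m + 1)) in
        if ereal \<iota> < R3_threshold \<Delta> (emp_smoothness X f g lt xbar \<Delta> m) then Exit_R3
        else Exit_R4 (search_pt X f g lt xbar \<Delta> ` {0..m}) \<iota> (2 * \<Delta> / \<iota>))"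
proof -
  have "step_dist X f g lt xbar \<Delta> t = \<infinity> \<longleftrightarrow> level_set X f g lt xbar \<Delta> t = {}" for t
    by (simp add: step_dist_def)
  then show ?thesis by (simp add: W_search_def Let_def)
qed

theorem proposition5p1:
  fixes X :: "'a::euclidean_space set" and f :: "'a \<Rightarrow> real" and g :: "'a \<Rightarrow> 'a"
    and lt :: "'a \<Rightarrow> 'a \<Rightarrow> real" and k m :: nat and L \<delta> \<Delta> :: real and xbar :: 'a
    and res :: "'a search_result"
  assumes "closed X" and "convex X"
    and "\<exists>C. C-lipschitz_on X f" and "bdd_below (f ` X)" and "minimizers X f \<noteq> {}"
    and "convex_on X f"
    and "\<And>x. x \<in> X \<Longrightarrow> is_subgradient X f x (g x)"
    and "apx_PWS_oracle X f k L \<delta> lt"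
    and "xbar \<in> X" and "\<Delta> > 0"
    and run: "W_search X f g lt xbar \<Delta> m \<infinity> = res"
  shows "(f xbar - min_val X f \<le> \<Delta> \<longrightarrow>
           (\<exists>S. res = Exit_R2 S \<and>
              (\<forall>\<^sub>F M in at_top. W_certificate X f g lt xbar S M (2 * \<Delta> / M))) \<or>
           (\<exists>S \<iota>. res = Exit_R4 S \<iota> (2 * \<Delta> / \<iota>) \<and>
              W_certificate X f g lt xbar S \<iota> (2 * \<Delta> / \<iota>))) \<and>
         (\<forall>S. res = Exit_R2 S \<longrightarrow>
           (\<forall>\<^sub>F M in at_top. W_certificate X f g lt xbar S M (2 * \<Delta> / M)) \<and>
           f xbar - min_val X f \<le> 2 * \<Delta>) \<and>
         (\<forall>S \<iota> \<nu> \<mu>. res = Exit_R4 S \<iota> \<nu> \<and> \<mu> > 0 \<and> quadratic_growth X f \<mu> \<longrightarrow>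
           W_certificate X f g lt xbar S \<iota> \<nu> \<and>
           ereal (f xbar - min_val X f)
             \<le> max 2 (32 * emp_smoothness X f g lt xbar \<Delta> m / ereal \<mu>) * ereal \<Delta> \<and>
           (\<delta> \<le> 1 / 6 * \<Delta> \<and> m \<ge> k \<longrightarrow>
              f xbar - min_val X f \<le> max 2 (32 * L / \<mu>) * \<Delta>))"
proof -
  have "continuous_on X f" using assms(3) lipschitz_on_continuous_on by blast
  interpret level_search X f g lt xbar \<Delta>
    using assms by unfold_locales (auto simp: apx_PWS_oracle_def)
  let ?Lt = "emp_smoothness X f g lt xbar \<Delta> m"
  show ?thesis
  proof (cases "\<exists>t\<le>m. Xl t = {}")
    case True
    define t where "t = (LEAST t. Xl t = {})"
    have "Xl t = {}" using True unfolding t_def by (metis (mono_tags, lifting) LeastI)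
    moreover have "\<And>s. s < t \<Longrightarrow> Xl s \<noteq> {}" unfolding t_def by (rule not_less_Least)
    ultimately have cert:
      "\<forall>\<^sub>F M in at_top. W_certificate X f g lt xbar (x ` {0..t}) M (2 * \<Delta> / M)"
      by (intro W_certificate_of_empty_Xl)
    have "res = Exit_R2 (x ` {0..t})"
      using run True by (simp add: W_search_infinite_radius t_def)
    then show ?thesis using cert gap_le_of_certificates_at_top[OF cert assms(5)] by simp
  next
    case False
    then interpret complete_level_search X f g lt xbar \<Delta> m by unfold_locales auto
    have res: "res = (if ?Lt < ereal (\<Delta> / (4 * \<iota>\<^sup>2)) then Exit_R3
        else Exit_R4 (x ` {0..m}) \<iota> (2 * \<Delta> / \<iota>))"
      using run False less_R3_threshold_iff[OF \<open>\<Delta> > 0\<close> radius_pos]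
      by (auto simp: W_search_infinite_radius Let_def)
    have exit_R4: "\<not> ?Lt < ereal (\<Delta> / (4 * \<iota>\<^sup>2))" if "f xbar - min_val X f \<le> \<Delta>"
    proof -
      have "f xbar - \<Delta> \<le> f y" if "y \<in> X" for y
        using min_val_le[OF assms(5) that] \<open>f xbar - min_val X f \<le> \<Delta>\<close> by simp
      then have "ereal (5 * \<Delta> / (3 * \<iota>\<^sup>2)) \<le> ?Lt" by (rule emp_smoothness_ge)
      moreover have "\<Delta> / (4 * \<iota>\<^sup>2) \<le> 5 * \<Delta> / (3 * \<iota>\<^sup>2)"
        using radius_pos \<open>\<Delta> > 0\<close> by (simp add: field_simps)
      ultimately show ?thesis by (meson ereal_less_eq(3) not_less order_trans)
    qed
    have gap: "f xbar - min_val X f \<le> max 2 (32 * c / \<mu>) * \<Delta>"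
      if "\<Delta> / (4 * \<iota>\<^sup>2) \<le> c" "\<mu> > 0" "quadratic_growth X f \<mu>" for c \<mu>
    proof -
      have "f xbar - min_val X f \<le> max (\<iota> * (2 * \<Delta> / \<iota>)) (2 * (2 * \<Delta> / \<iota>)\<^sup>2 / \<mu>)"
        using W_certificate_gap[OF W_certificate_last] assms(1,5) \<open>continuous_on X f\<close> that by blast
      also have "\<iota> * (2 * \<Delta> / \<iota>) = 2 * \<Delta>" using radius_pos by simp
      \<comment> \<open>The factor \<open>32\<close> is \<open>2 * 2\<^sup>2\<close> from the certificate times \<open>4\<close> from the squared threshold.\<close>
      also have "2 * (2 * \<Delta> / \<iota>)\<^sup>2 / \<mu> = 32 * (\<Delta> / (4 * \<iota>\<^sup>2)) / \<mu> * \<Delta>"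
        by (simp add: power2_eq_square)
      also have "max (2 * \<Delta>) (32 * (\<Delta> / (4 * \<iota>\<^sup>2)) / \<mu> * \<Delta>) =
          max 2 (32 * (\<Delta> / (4 * \<iota>\<^sup>2)) / \<mu>) * \<Delta>"
        using \<open>\<Delta> > 0\<close> by (simp only: max_mult_distrib_right if_True less_imp_le)
      also have "\<dots> \<le> max 2 (32 * c / \<mu>) * \<Delta>"
        using that \<open>\<Delta> > 0\<close> by (intro mult_right_mono max.mono divide_right_mono mult_left_mono) auto
      finally show ?thesis .
    qed
    have gap_emp: "ereal (f xbar - min_val X f) \<le> max 2 (32 * ?Lt / ereal \<mu>) * ereal \<Delta>"
      if "ereal (\<Delta> / (4 * \<iota>\<^sup>2)) \<le> ?Lt" "\<mu> > 0" "quadratic_growth X f \<mu>" for \<mu>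
    proof (cases ?Lt)
      case (real c)
      have "max 2 (32 * ?Lt / ereal \<mu>) * ereal \<Delta> = ereal (max 2 (32 * c / \<mu>) * \<Delta>)"
        using real \<open>\<mu> > 0\<close> by (simp add: max_def)
      then show ?thesis using gap[of c \<mu>] that real by simp
    next
      case PInf
      then show ?thesis using \<open>\<mu> > 0\<close> \<open>\<Delta> > 0\<close> by (simp add: divide_ereal_def max_def)
    next
      case MInf
      then show ?thesis using that by simp
    qed
    have gap_L: "f xbar - min_val X f \<le> max 2 (32 * L / \<mu>) * \<Delta>"
      if "ereal (\<Delta> / (4 * \<iota>\<^sup>2)) \<le> ?Lt" "\<mu> > 0" "quadratic_growth X f \<mu>"
        "\<delta> \<le> 1 / 6 * \<Delta>" "k \<le> m" for \<mu>
    proof -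
      have "?Lt \<le> ereal L" using emp_smoothness_le[OF assms(8)] that by simp
      then have "\<Delta> / (4 * \<iota>\<^sup>2) \<le> L" using that(1) by (meson ereal_less_eq(3) order_trans)
      then show ?thesis using gap that by blast
    qed
    show ?thesis
      using res exit_R4 W_certificate_last gap_emp gap_L
      by (auto simp: not_less split: if_splits)
  qed
qed

end
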